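(* The set $\mathbb{G}$ is dense in $C(\lambda)$ with respect to the uniform metric $\rho$. That is, for every $b\in C(\lambda)$ and every $\epsilon>0$ there exists $g\in\mathbb{G}$ such that $\rho(b,g)<\epsilon$.
   Context: $\lambda$ is Lebesgue measure on $[0,1]$. A continuous map $h:[0,1]\to[0,1]$ is $\lambda$-preserving if $\lambda(A)=\lambda(h^{-1}(A))$ for every Borel set $A\subseteq[0,1]$. $C(\lambda)$ is the set of all continuous $\lambda$-preserving maps $[0,1]\to[0,1]$. The metric is $\rho(h_1,h_2)=\sup_{x\in[0,1]}|h_1(x)-h_2(x)|$. A dyadic number is a rational number whose denominator is an integer power of $2$. $\mathbb{G}$ ($\lambda$-preserving Thompson's monoid) is the set of continuous maps $g$ from $[0,1]$ onto $[0,1]$ such that: $g$ is $\lambda$-preserving; $g$ is piecewise affine; $g$ is differentiable except at finitely many points; the $x$-coordinate of each point of non-differentiability is dyadic; and on every interval where $g$ is differentiable, the derivative is positive or negative with absolute value an integer power of $2$ (i.e. of the form $\pm 2^k$, $k\in\mathbb{Z}$). *)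

theory Defs
  imports "HOL-Analysis.Analysis"
begin

text \<open>
  Maps \<open>[0,1] \<rightarrow> [0,1]\<close> are elements of the extensional function space
  \<open>{0..1} \<rightarrow>\<^sub>E {0..1}\<close>. Continuity, differentiability and derivatives are therefore
  always taken within \<open>{0..1}\<close>, hence one-sided at the two endpoints.
\<close>

definition lambda_preserving :: "(real \<Rightarrow> real) \<Rightarrow> bool" where
  "lambda_preserving h \<longleftrightarrow>
     (\<forall>A\<in>sets borel. A \<subseteq> {0..1} \<longrightarrow>
        emeasure (lebesgue_on {0..1}) A = emeasure (lebesgue_on {0..1}) (h -` A \<inter> {0..1}))"

definition C_lambda :: "(real \<Rightarrow> real) set" where
  "C_lambda = {h \<in> {0..1} \<rightarrow>\<^sub>E {0..1}. continuous_on {0..1} h \<and> lambda_preserving h}"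

definition rho :: "(real \<Rightarrow> real) \<Rightarrow> (real \<Rightarrow> real) \<Rightarrow> real" where
  "rho h1 h2 = (SUP x\<in>{0..1}. \<bar>h1 x - h2 x\<bar>)"

definition dyadic :: "real \<Rightarrow> bool" where
  "dyadic x \<longleftrightarrow> (\<exists>(a::int) (n::nat). x = of_int a / 2 ^ n)"

definition piecewise_affine :: "(real \<Rightarrow> real) \<Rightarrow> bool" where
  "piecewise_affine h \<longleftrightarrow>
     (\<exists>(n::nat) (t::nat \<Rightarrow> real). t 0 = 0 \<and> t n = 1 \<and> (\<forall>i<n. t i < t (Suc i)) \<and>
        (\<forall>i<n. \<exists>m c. \<forall>x\<in>{t i..t (Suc i)}. h x = m * x + c))"

definition nondiff_points :: "(real \<Rightarrow> real) \<Rightarrow> real set" where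
  "nondiff_points h = {x \<in> {0..1}. \<not> h differentiable (at x within {0..1})}"

text \<open>
  Closed affine pieces in \<open>piecewise_affine\<close> lose no generality, as the maps below are continuous.
  Since \<open>nondiff_points g\<close> is required to be finite, every point of differentiability lies in an
  interval on which \<open>g\<close> is differentiable, so the condition on the derivative over all such
  intervals is the pointwise one.
\<close>

definition G_monoid :: "(real \<Rightarrow> real) set" where
  "G_monoid = {g \<in> {0..1} \<rightarrow>\<^sub>E {0..1}.
     continuous_on {0..1} g \<and> g ` {0..1} = {0..1} \<and>
     lambda_preserving g \<and>
     piecewise_affine g \<and>
     finite (nondiff_points g) \<and>
     (\<forall>x\<in>nondiff_points g. dyadic x) \<and>
     (\<forall>x\<in>{0..1}. \<forall>d. (g has_real_derivative d) (at x within {0..1}) \<longrightarrow>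
        (\<exists>k::int. \<bar>d\<bar> = 2 powi k))}"

end

theory Submission
  imports Defs
begin

text \<open>
  Cut the range into \<open>K = 2 ^ m\<close> cells. A piecewise linear map whose graph follows a walk on the
  grid \<open>{0, 1/K, \<dots>, 1}\<close>, each step taking a time that is a power of two, lies in \<open>G_monoid\<close>
  as soon as every cell is crossed for a total time of \<open>1/K\<close>. Given \<open>b\<close>, cut the domain into
  intervals \<open>I i\<close> and let \<open>mass i j\<close> be the measure of the part of \<open>I i\<close> that \<open>b\<close> maps into cell
  \<open>j\<close>; its column sums are \<open>1/K\<close>. As \<open>b\<close> is continuous, the cells \<open>j\<close> with \<open>mass i j > 0\<close> are
  consecutive, and consecutive rows share a grid point. Hence, after rounding the masses to dyadic
  numbers with the same column sums, there is a walk that in its \<open>i\<close>-th part spends exactly the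
  rounded time \<open>mass i j\<close> in each cell \<open>j\<close>, and the corresponding map is uniformly close to \<open>b\<close>.
\<close>

subsection \<open>Dyadic numbers\<close>

lemma dyadic_0: "dyadic 0"
  unfolding dyadic_def by (rule exI[of _ 0]) simp

lemma dyadic_add:
  assumes "dyadic x" "dyadic y"
  shows "dyadic (x + y)"
proof -
  obtain a b n m where "x = of_int a / 2 ^ n" "y = of_int b / 2 ^ m"
    using assms unfolding dyadic_def by blast
  then have "x + y = of_int (a * 2 ^ m + b * 2 ^ n) / 2 ^ (n + m)"
    by (simp add: power_add add_divide_distrib)
  then show ?thesis
    unfolding dyadic_def by blast
qed

lemma dyadic_uminus: "dyadic x \<Longrightarrow> dyadic (- x)"
  unfolding dyadic_def by (metis of_int_minus minus_divide_left)

lemma dyadic_diff: "dyadic x \<Longrightarrow> dyadic y \<Longrightarrow> dyadic (x - y)"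
  using dyadic_add[of x "- y"] dyadic_uminus by simp

lemma dyadic_sum: "(\<And>i. i \<in> S \<Longrightarrow> dyadic (f i)) \<Longrightarrow> dyadic (sum f S)"
  by (induction S rule: infinite_finite_induct) (auto simp: dyadic_0 dyadic_add)

lemma dyadic_divide_power: "dyadic x \<Longrightarrow> dyadic (x / 2 ^ k)"
  unfolding dyadic_def by (metis divide_divide_eq_left power_add)

lemma dyadic_powi: "dyadic (2 powi k)"
proof (cases "k \<ge> 0")
  case True
  then have "(2::real) powi k = of_int (2 ^ nat k) / 2 ^ 0"
    by (simp add: power_int_def)
  then show ?thesis unfolding dyadic_def by blast
next
  case False
  then have "(2::real) powi k = of_int 1 / 2 ^ nat (- k)"
    by (simp add: power_int_def field_simps)
  then show ?thesis unfolding dyadic_def by blast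
qed

lemma dyadic_posE:
  assumes "dyadic x" "0 < x"
  obtains a p :: nat where "0 < a" "x = real a / 2 ^ p"
proof -
  obtain a :: int and p where x: "x = of_int a / 2 ^ p"
    using assms unfolding dyadic_def by blast
  with assms have "0 < a"
    by (simp add: zero_less_divide_iff)
  then show ?thesis
    using that[of "nat a" p] x by simp
qed

text \<open>Once the mesh \<open>1 / 2 ^ n\<close> is smaller than \<open>y - x\<close>, the first
  grid point strictly above \<open>x\<close> still lies below \<open>y\<close>.\<close>

lemma dyadic_dense:
  fixes x y :: real
  assumes "x < y"
  shows "\<exists>d. dyadic d \<and> x < d \<and> d < y"
proof -
  obtain n where n: "1 / (y - x) < 2 ^ n"
    using real_arch_pow[of 2] by auto
  define d where "d = of_int (\<lfloor>x * 2 ^ n\<rfloor> + 1) / (2::real) ^ n"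
  have "x * 2 ^ n + 1 < y * 2 ^ n"
    using n assms by (simp add: field_simps)
  moreover have "x * 2 ^ n < of_int (\<lfloor>x * 2 ^ n\<rfloor> + 1)" "of_int (\<lfloor>x * 2 ^ n\<rfloor> + 1) \<le> x * 2 ^ n + 1"
    by (simp_all add: floor_correct)
  ultimately have "x < d" "d < y"
    unfolding d_def pos_less_divide_eq[OF zero_less_power[OF zero_less_numeral]]
      pos_divide_less_eq[OF zero_less_power[OF zero_less_numeral]] by linarith+
  then show ?thesis
    unfolding dyadic_def d_def by blast
qed

text \<open>All values but one are rounded down to dyadic numbers, and the remaining one absorbs the
  total deficit. It stays dyadic, being a difference of dyadic numbers.\<close>

lemma dyadic_rounding:
  assumes "finite S" "S \<noteq> {}" and pos: "\<And>i. i \<in> S \<Longrightarrow> 0 < \<mu> i"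
    and "dyadic (sum \<mu> S)" and "0 < \<eta>"
  shows "\<exists>P. (\<forall>i\<in>S. dyadic (P i) \<and> 0 < P i \<and> \<bar>P i - \<mu> i\<bar> < \<eta>) \<and> sum P S = sum \<mu> S"
proof -
  \<comment> \<open>There are \<open>card S - 1\<close> deficits, each below
    \<open>\<delta>\<close>, so together they stay below \<open>\<eta>\<close>.\<close>
  define \<delta> where "\<delta> = \<eta> / card S"
  have card: "0 < card S"
    using assms by (simp add: card_gt_0_iff)
  then have \<delta>: "0 < \<delta>" "\<delta> \<le> \<eta>" "card S * \<delta> = \<eta>"
    using \<open>0 < \<eta>\<close> by (auto simp: \<delta>_def field_simps)
  obtain s where s: "s \<in> S"
    using assms by blast
  have "\<exists>d. dyadic d \<and> max 0 (\<mu> i - \<delta>) < d \<and> d < \<mu> i" if "i \<in> S" for i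
    using pos[OF that] \<delta> by (intro dyadic_dense) auto
  then obtain p where p: "\<And>i. i \<in> S \<Longrightarrow> dyadic (p i) \<and> max 0 (\<mu> i - \<delta>) < p i \<and> p i < \<mu> i"
    by metis
  define P where "P = p(s := sum \<mu> S - sum p (S - {s}))"
  have sumP: "sum P S = sum \<mu> S"
    using s \<open>finite S\<close> by (simp add: P_def sum.remove)
  have Ps: "P s - \<mu> s = (\<Sum>i\<in>S - {s}. \<mu> i - p i)"
    using s \<open>finite S\<close> by (simp add: P_def sum.remove[of S s] sum_subtractf)
  have "0 \<le> P s - \<mu> s"
    unfolding Ps by (rule sum_nonneg) (use p in \<open>auto intro: less_imp_le\<close>)
  moreover have "P s - \<mu> s < \<eta>"
  proof -
    have "P s - \<mu> s \<le> (\<Sum>i\<in>S - {s}. \<delta>)"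
      unfolding Ps by (rule sum_mono) (use p in force)
    also have "\<dots> = (card S - 1) * \<delta>"
      using s by simp
    also have "\<dots> < card S * \<delta>"
      using \<delta> card by (intro mult_strict_right_mono) auto
    finally show ?thesis using \<delta> by simp
  qed
  moreover have "dyadic (P s)"
    unfolding P_def using assms p by (auto intro!: dyadic_diff dyadic_sum)
  moreover have "dyadic (P i) \<and> 0 < P i \<and> \<bar>P i - \<mu> i\<bar> < \<eta>" if "i \<in> S" "i \<noteq> s" for i
    using p[OF that(1)] that(2) \<delta> by (auto simp: P_def)
  ultimately show ?thesis
    using sumP pos[OF s] by (intro exI[of _ P]) force
qed

subsection \<open>Walks on the grid\<close>

text \<open>A step \<open>(v, v', w)\<close> stands for going from grid point \<open>v\<close> to
  \<open>v'\<close> in time \<open>w\<close>. The edge between neighbours is indexed by its lower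
  end, so that both directions of travel share one \<open>cell\<close>.\<close>

type_synonym step = "nat \<times> nat \<times> real"

fun cell :: "step \<Rightarrow> nat" where
  "cell (v, v', w) = min v v'"

fun time :: "step \<Rightarrow> real" where
  "time (v, v', w) = w"

text \<open>Times are powers of two because a step of height \<open>1 / 2 ^ m\<close> and time
  \<open>w\<close> has slope of absolute value \<open>1 / (2 ^ m * w)\<close>.\<close>

fun walk :: "nat \<Rightarrow> step list \<Rightarrow> nat \<Rightarrow> bool" where
  "walk u [] u' \<longleftrightarrow> u = u'"
| "walk u ((v, v', w) # xs) u' \<longleftrightarrow>
     v = u \<and> (v' = Suc v \<or> v = Suc v') \<and> (\<exists>k::int. w = 2 powi k) \<and> walk v' xs u'"

text \<open>With \<open>K\<close> cells of height \<open>1 / K\<close>, a load of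
  \<open>1 / K\<close> says that the reciprocals of the absolute slopes over that cell add up to
  one, which is invariance of Lebesgue measure there.\<close>

definition load :: "step list \<Rightarrow> nat \<Rightarrow> real" where
  "load xs j = (\<Sum>x\<leftarrow>xs. if cell x = j then time x else 0)"

definition duration :: "step list \<Rightarrow> real" where
  "duration xs = (\<Sum>x\<leftarrow>xs. time x)"

text \<open>The loads agree on all naturals; as steps take positive time, such a walk crosses no
  cell where \<open>f\<close> vanishes.\<close>

definition connects :: "nat \<Rightarrow> nat \<Rightarrow> (nat \<Rightarrow> real) \<Rightarrow> bool" where
  "connects u u' f \<longleftrightarrow> (\<exists>xs. walk u xs u' \<and> load xs = f)"

lemma load_Nil [simp]: "load [] j = 0"
  and load_Cons [simp]: "load (x # xs) j = (if cell x = j then time x else 0) + load xs j"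
  and load_append [simp]: "load (xs @ ys) j = load xs j + load ys j"
  by (simp_all add: load_def)

lemma duration_Nil [simp]: "duration [] = 0"
  and duration_Cons [simp]: "duration (x # xs) = time x + duration xs"
  and duration_append [simp]: "duration (xs @ ys) = duration xs + duration ys"
  by (simp_all add: duration_def)

lemma walk_append: "walk u xs v \<Longrightarrow> walk v ys w \<Longrightarrow> walk u (xs @ ys) w"
  by (induction u xs v rule: walk.induct) auto

lemma walk_time_pos: "walk u xs u' \<Longrightarrow> x \<in> set xs \<Longrightarrow> 0 < time x"
  by (induction u xs u' rule: walk.induct) auto

lemma load_nonneg: "(\<And>x. x \<in> set xs \<Longrightarrow> 0 < time x) \<Longrightarrow> 0 \<le> load xs j"
  by (induction xs) (auto simp: add_nonneg_nonneg less_imp_le)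

lemma duration_nonneg: "(\<And>x. x \<in> set xs \<Longrightarrow> 0 < time x) \<Longrightarrow> 0 \<le> duration xs"
  by (induction xs) (auto simp: add_nonneg_nonneg less_imp_le)

lemma load_pos:
  assumes "\<And>x. x \<in> set xs \<Longrightarrow> 0 < time x" "x \<in> set xs"
  shows "0 < load xs (cell x)"
  using assms
proof (induction xs)
  case (Cons y ys)
  then show ?case
    using load_nonneg[of ys "cell x"] by (cases "x = y") (auto simp: add_pos_nonneg add_nonneg_pos less_imp_le)
qed simp

lemma duration_eq_sum_load:
  assumes "\<And>x. x \<in> set xs \<Longrightarrow> cell x < K"
  shows "duration xs = (\<Sum>j<K. load xs j)"
  using assms by (induction xs) (auto simp: sum.distrib)

section \<open>Walks with prescribed cell times\<close>

lemma connects_refl: "connects u u (\<lambda>_. 0)"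
  unfolding connects_def by (rule exI[of _ "[]"]) (auto simp: fun_eq_iff)

lemma connects_trans:
  "connects u v f \<Longrightarrow> connects v w g \<Longrightarrow> connects u w (\<lambda>j. f j + g j)"
  unfolding connects_def using walk_append load_append by (metis ext)

lemma connects_step:
  fixes k :: int
  assumes "v' = Suc v \<or> v = Suc v'"
  shows "connects v v' (\<lambda>j. if j = min v v' then 2 powi k else 0)"
  unfolding connects_def
  using assms by (intro exI[of _ "[(v, v', 2 powi k)]"]) (auto simp: fun_eq_iff)

text \<open>
  An edge can be crossed in any dyadic time \<open>a / 2 ^ p\<close>, with a single step if \<open>a \<le> 2\<close>; going
  back and forth once more adds two units of time.
\<close>
lemma connects_dyadic_step:
  assumes "v' = Suc v \<or> v = Suc v'" and "dyadic w" "0 < w"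
  shows "connects v v' (\<lambda>j. if j = min v v' then w else 0)"
proof -
  obtain a p :: nat where a: "0 < a" and w: "w = real a / 2 ^ p"
    using assms dyadic_posE by metis
  define C where "C u u' a \<longleftrightarrow> connects u u' (\<lambda>j. if j = min v v' then real a / 2 ^ p else 0)" for u u' a
  have one: "C v v' 1" "C v' v 1"
    using assms(1) connects_step[of v' v "- int p"] connects_step[of v v' "- int p"]
    by (auto simp: C_def power_int_minus inverse_eq_divide min.commute cong: if_cong)
  have two: "C v v' 2"
    using assms(1) connects_step[of v' v "1 - int p"] by (simp add: C_def power_int_diff cong: if_cong)
  have add: "C u w (a + b)" if "C u u' a" "C u' w b" for u u' w a b
  proof -
    have "connects u w (\<lambda>j. (if j = min v v' then real a / 2 ^ p else 0) + (if j = min v v' then real b / 2 ^ p else 0))"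
      using that connects_trans unfolding C_def by blast
    then show ?thesis
      unfolding C_def by (rule back_subst[where P = "connects u w"]) (auto simp: add_divide_distrib)
  qed
  have "0 < a \<Longrightarrow> C v v' a"
  proof (induction a rule: less_induct)
    case (less a)
    consider "a = 1" | "a = 2" | "a > 2"
      using less.prems by linarith
    then show ?case
    proof cases
      case 3
      then have "C v v' (a - 2 + (1 + 1))"
        by (intro add[OF less.IH add[OF one(2) one(1)]]) auto
      moreover have "a - 2 + (1 + 1) = a"
        using 3 by simp
      ultimately show ?thesis by (simp only:)
    qed (use one two in auto)
  qed
  then show ?thesis
    using a unfolding C_def w by blast
qed

text \<open>Each edge between \<open>a\<close> and \<open>e\<close> is crossed by one application of
  \<open>connects_dyadic_step\<close>; a new top edge is appended on the way up and prepended on the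
  way down.\<close>

lemma connects_monotone:
  assumes "a \<le> e" and "\<And>j. a \<le> j \<Longrightarrow> j < e \<Longrightarrow> dyadic (f j) \<and> 0 < f j"
  shows "connects a e (\<lambda>j. if a \<le> j \<and> j < e then f j else 0)"
    and "connects e a (\<lambda>j. if a \<le> j \<and> j < e then f j else 0)"
  using assms
proof (induction e rule: dec_induct)
  case base
  {
    case 1
    show ?case by (rule back_subst[where P = "connects a a", OF connects_refl]) auto
  next
    case 2
    show ?case by (rule back_subst[where P = "connects a a", OF connects_refl]) auto
  }
next
  case (step e)
  {
    case 1
    have "connects a e (\<lambda>j. if a \<le> j \<and> j < e then f j else 0)"
      using step 1 by simp
    moreover have "connects e (Suc e) (\<lambda>j. if j = min e (Suc e) then f e else 0)"
      using step 1 by (intro connects_dyadic_step) auto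
    ultimately have "connects a (Suc e)
        (\<lambda>j. (if a \<le> j \<and> j < e then f j else 0) + (if j = min e (Suc e) then f e else 0))"
      by (rule connects_trans)
    then show ?case
      by (rule back_subst[where P = "connects a (Suc e)"]) (use step in \<open>auto simp: fun_eq_iff less_Suc_eq\<close>)
  next
    case 2
    have "connects e a (\<lambda>j. if a \<le> j \<and> j < e then f j else 0)"
      using step 2 by simp
    moreover have "connects (Suc e) e (\<lambda>j. if j = min (Suc e) e then f e else 0)"
      using step 2 by (intro connects_dyadic_step) auto
    ultimately have "connects (Suc e) a
        (\<lambda>j. (if j = min (Suc e) e then f e else 0) + (if a \<le> j \<and> j < e then f j else 0))"
      using connects_trans by blast
    then show ?case
      by (rule back_subst[where P = "connects (Suc e) a"]) (use step in \<open>auto simp: fun_eq_iff less_Suc_eq\<close>)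
  }
qed

text \<open>
  Walk down from \<open>u\<close> to \<open>a\<close>, up to \<open>e\<close>, down to \<open>u'\<close>; the two descents spend a quarter of the
  available time in each cell they cross.
\<close>
lemma connects_interval:
  assumes "a \<le> u" "u \<le> e" "a \<le> u'" "u' \<le> e"
    and f: "\<And>j. a \<le> j \<Longrightarrow> j < e \<Longrightarrow> dyadic (f j) \<and> 0 < f j"
    and f0: "\<And>j. \<not> (a \<le> j \<and> j < e) \<Longrightarrow> f j = 0"
  shows "connects u u' f"
proof -
  define q where "q j = f j / 4" for j
  have q: "dyadic (q j) \<and> 0 < q j" if "a \<le> j" "j < e" for j
    using f[OF that] dyadic_divide_power[of "f j" 2] by (simp add: q_def)
  \<comment> \<open>The ascent receives what the two descents leave over. At most two quarters are
    taken from a cell, so at least half of \<open>f j\<close> remains.\<close>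
  define r where "r j = f j - (if j < u then q j else 0) - (if u' \<le> j then q j else 0)" for j
  have r: "dyadic (r j) \<and> 0 < r j" if "a \<le> j" "j < e" for j
  proof
    show "dyadic (r j)"
      unfolding r_def using f[OF that] q[OF that] by (intro dyadic_diff) (auto simp: dyadic_0)
    show "0 < r j"
      using f[OF that] by (auto simp: r_def q_def)
  qed
  have "connects u a (\<lambda>j. if a \<le> j \<and> j < u then q j else 0)"
    using assms q by (intro connects_monotone) auto
  moreover have "connects a e (\<lambda>j. if a \<le> j \<and> j < e then r j else 0)"
    using assms r by (intro connects_monotone) auto
  moreover have "connects e u' (\<lambda>j. if u' \<le> j \<and> j < e then q j else 0)"
    using assms q by (intro connects_monotone) auto
  ultimately have "connects u u' (\<lambda>j. (if a \<le> j \<and> j < u then q j else 0) +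
      ((if a \<le> j \<and> j < e then r j else 0) + (if u' \<le> j \<and> j < e then q j else 0)))"
    using connects_trans by blast
  then show ?thesis
    by (rule back_subst[where P = "connects u u'"]) (use assms in \<open>auto simp: fun_eq_iff r_def\<close>)
qed

text \<open>The walk of each row ends where that of the next begins. The last conjunct locates every
  step in the time window of a row \<open>i\<close> that has positive time in the crossed cell; the
  uniform estimate rests on this.\<close>

lemma concat_walks:
  assumes "\<And>i. i < N \<Longrightarrow> connects (u i) (u (Suc i)) (P i)"
    and P0: "\<And>i j. i < N \<Longrightarrow> K \<le> j \<Longrightarrow> P i j = 0"
  shows "\<exists>xs. walk (u 0) xs (u N) \<and> load xs = (\<lambda>j. \<Sum>i<N. P i j) \<and>
    duration xs = (\<Sum>i<N. \<Sum>j<K. P i j) \<and>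
    (\<forall>k<length xs. \<exists>i<N. (\<Sum>i'<i. \<Sum>j<K. P i' j) \<le> duration (take k xs) \<and>
       duration (take (Suc k) xs) \<le> (\<Sum>i'<Suc i. \<Sum>j<K. P i' j) \<and> 0 < P i (cell (xs ! k)))"
  using assms
proof (induction N)
  case 0
  show ?case by (rule exI[of _ "[]"]) auto
next
  case (Suc N)
  define T where "T i = (\<Sum>i'<i. \<Sum>j<K. P i' j)" for i
  obtain xs where xs: "walk (u 0) xs (u N)" "load xs = (\<lambda>j. \<Sum>i<N. P i j)" "duration xs = T N"
    "\<And>k. k < length xs \<Longrightarrow> \<exists>i<N. T i \<le> duration (take k xs) \<and>
       duration (take (Suc k) xs) \<le> T (Suc i) \<and> 0 < P i (cell (xs ! k))"
    using Suc.IH Suc.prems unfolding T_def by (auto simp: less_Suc_eq)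
  obtain ys where ys: "walk (u N) ys (u (Suc N))" "load ys = P N"
    using Suc.prems unfolding connects_def by blast
  note pos = walk_time_pos[OF ys(1)]
  have cellP: "0 < P N (cell y)" if "y \<in> set ys" for y
    using load_pos[OF pos that] ys(2) by simp
  have "cell y < K" if "y \<in> set ys" for y
    using cellP[OF that] Suc.prems(2)[of N "cell y"] by force
  then have dur: "duration ys = (\<Sum>j<K. P N j)"
    using duration_eq_sum_load[of ys K] ys(2) by simp
  \<comment> \<open>Partial durations lie between zero and the total, so the steps of the appended
    walk stay in the last time window.\<close>
  have le: "duration (take k ys) \<le> duration ys" "0 \<le> duration (take k ys)" for k
  proof -
    have "0 \<le> duration (drop k ys)" "0 \<le> duration (take k ys)"
      using pos by (auto intro!: duration_nonneg dest: in_set_dropD in_set_takeD)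
    then show "duration (take k ys) \<le> duration ys" "0 \<le> duration (take k ys)"
      using duration_append[of "take k ys" "drop k ys"] by simp_all
  qed
  have "\<exists>i<Suc N. T i \<le> duration (take k (xs @ ys)) \<and>
       duration (take (Suc k) (xs @ ys)) \<le> T (Suc i) \<and> 0 < P i (cell ((xs @ ys) ! k))"
    if "k < length (xs @ ys)" for k
  proof (cases "k < length xs")
    case True
    then show ?thesis
      using xs(4)[OF True] by (auto simp: nth_append less_Suc_eq)
  next
    case False
    then have "ys ! (k - length xs) \<in> set ys"
      using that by simp
    then show ?thesis
      using False le[of "k - length xs"] le[of "Suc k - length xs"] dur xs(3) cellP
      by (intro exI[of _ N]) (auto simp: nth_append T_def)
  qed
  then show ?case
    using walk_append[OF xs(1) ys(1)] xs(2,3) ys(2) dur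
    by (intro exI[of _ "xs @ ys"]) (auto simp: T_def)
qed

subsection \<open>Splitting Lebesgue measure\<close>

lemma steps_mono:
  fixes s :: "nat \<Rightarrow> real"
  assumes "i \<le> j" "j \<le> n" "\<And>i. i < n \<Longrightarrow> s i < s (Suc i)"
  shows "s i \<le> s j"
  using assms
proof (induction j rule: dec_induct)
  case (step k)
  then have "s i \<le> s k" "s k < s (Suc k)"
    by auto
  then show ?case by simp
qed simp

lemma steps_cover_closed:
  fixes s :: "nat \<Rightarrow> real"
  assumes "s 0 \<le> y" "y \<le> s n" "0 < n"
  shows "\<exists>i<n. s i \<le> y \<and> y \<le> s (Suc i)"
  using assms
proof (induction n)
  case (Suc n)
  show ?case
  proof (cases "y \<le> s n \<and> 0 < n")
    case True
    then obtain i where "i < n" "s i \<le> y" "y \<le> s (Suc i)"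
      using Suc by blast
    then show ?thesis
      by (intro exI[of _ i]) simp
  next
    case False
    then show ?thesis
      using Suc.prems by (intro exI[of _ n]) (cases "n = 0"; simp)
  qed
qed simp

lemma steps_cover:
  fixes s :: "nat \<Rightarrow> real"
  assumes "s 0 \<le> y" "y \<le> s n"
  shows "y \<in> s ` {..n} \<or> (\<exists>i<n. s i < y \<and> y < s (Suc i))"
proof (cases "n = 0")
  case False
  then obtain i where "i < n" "s i \<le> y" "y \<le> s (Suc i)"
    using steps_cover_closed assms by blast
  then show ?thesis
    by (cases "y = s i \<or> y = s (Suc i)") force+
qed (use assms in auto)

text \<open>The open pieces are disjoint and miss only the fibres over finitely many breakpoints,
  which are null. The identity as \<open>f\<close> cuts the domain; a measure-preserving map as
  \<open>f\<close> cuts by its range.\<close>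

lemma measure_pieces:
  fixes f :: "real \<Rightarrow> real"
  assumes B: "B \<in> fmeasurable lborel" and f: "f \<in> borel_measurable borel"
    and range: "\<And>x. x \<in> B \<Longrightarrow> s 0 \<le> f x \<and> f x \<le> s n"
    and less: "\<And>i. i < n \<Longrightarrow> s i < s (Suc i)"
    and null: "\<And>y. measure lborel (B \<inter> f -` {y}) = 0"
  shows "measure lborel B = (\<Sum>j<n. measure lborel (B \<inter> f -` {s j<..<s (Suc j)}))"
proof -
  define C where "C j = B \<inter> f -` {s j<..<s (Suc j)}" for j
  define D where "D = (\<Union>j\<le>n. B \<inter> f -` {s j})"
  have meas: "B \<inter> f -` S \<in> fmeasurable lborel" if "S \<in> sets borel" for S
    using measurable_sets[OF f that] B by (intro fmeasurable_Int_fmeasurable) auto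
  have "D \<in> null_sets lborel"
    unfolding D_def
  proof (intro null_sets_UN' countable_finite finite_atMost)
    fix j
    show "B \<inter> f -` {s j} \<in> null_sets lborel"
      \<comment> \<open>Since \<open>measure\<close> sends infinite measure to zero, finiteness is
        what turns measure zero into a null set.\<close>
      using null[of "s j"] meas[of "{s j}"]
      by (auto simp: null_sets_def fmeasurable_def measure_def enn2real_eq_0_iff)
  qed
  then have "measure lborel B = measure lborel (B - D)"
    using B by (metis measure_Diff_null_set fmeasurableD)
  also have "B - D = (\<Union>j<n. C j)"
  proof -
    have 1: "s i \<noteq> f x" if "x \<in> C j" "i \<le> n" "j < n" for x i j
    proof (cases "i \<le> j")
      case True
      then show ?thesis
        using that steps_mono[of i j n s] less by (auto simp: C_def)
    next
      case False
      then show ?thesis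
        using that steps_mono[of "Suc j" i n s] less by (auto simp: C_def)
    qed
    have 2: "f x \<in> s ` {..n} \<or> (\<exists>j<n. x \<in> C j)" if "x \<in> B" for x
      using steps_cover[of s "f x" n] range[OF that] that by (auto simp: C_def)
    have 3: "x \<in> D \<longleftrightarrow> x \<in> B \<and> f x \<in> s ` {..n}" for x
      by (auto simp: D_def)
    show ?thesis
    proof (intro set_eqI iffI)
      fix x assume "x \<in> B - D"
      with 2 3 show "x \<in> (\<Union>j<n. C j)" by blast
    next
      fix x assume "x \<in> (\<Union>j<n. C j)"
      then obtain j where j: "j < n" "x \<in> C j" by blast
      then have "x \<in> B" by (simp add: C_def)
      moreover have "x \<notin> D"
      proof
        assume "x \<in> D"
        then obtain i where "i \<le> n" "f x = s i"
          unfolding 3 by blast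
        with 1[OF j(2) _ j(1)] show False by metis
      qed
      ultimately show "x \<in> B - D" by blast
    qed
  qed
  also have "measure lborel \<dots> = (\<Sum>j<n. measure lborel (C j))"
  proof (rule measure_UNION')
    have disj: "C i \<inter> C j = {}" if "i < j" "j < n" for i j
    proof -
      have "s (Suc i) \<le> s j"
        using that less by (intro steps_mono[of "Suc i" j n s]) auto
      then show ?thesis
        by (auto simp: C_def)
    qed
    show "pairwise (\<lambda>i j. disjnt (C i) (C j)) {..<n}"
    proof (intro pairwiseI)
      fix i j assume "i \<in> {..<n}" "j \<in> {..<n}" "i \<noteq> j"
      then show "disjnt (C i) (C j)"
        using disj[of i j] disj[of j i] unfolding disjnt_def
        by (cases i j rule: linorder_cases) (simp_all add: Int_commute)
    qed
  qed (auto simp: C_def meas)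
  finally show ?thesis
    by (simp add: C_def)
qed

lemma fmeasurable_unit: "B \<in> sets borel \<Longrightarrow> B \<subseteq> {0..1::real} \<Longrightarrow> B \<in> fmeasurable lborel"
  by (rule fmeasurableI2[of "{0..1}"]) (auto simp: fmeasurable_def)

lemma measure_subintervals:
  fixes s :: "nat \<Rightarrow> real"
  assumes B: "B \<in> sets borel" "B \<subseteq> {0..1::real}" and s: "s 0 = 0" "s n = 1"
    and less: "\<And>i. i < n \<Longrightarrow> s i < s (Suc i)"
  shows "measure lborel B = (\<Sum>j<n. measure lborel (B \<inter> {s j<..<s (Suc j)}))"
proof -
  have "measure lborel (B \<inter> {y}) = 0" for y
    by (cases "y \<in> B") auto
  then show ?thesis
    using measure_pieces[OF fmeasurable_unit[OF B], of "\<lambda>x. x" s n] B(2) s less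
    by (simp add: subset_iff)
qed

lemma measure_affine_vimage:
  fixes a c :: real
  assumes "A \<in> sets borel" "a \<noteq> 0"
  shows "measure lborel {x. a * x + c \<in> A} = measure lborel A / \<bar>a\<bar>"
proof -
  have "emeasure lborel A = emeasure (density (distr lborel borel (\<lambda>x. c + a * x)) (\<lambda>_. ennreal \<bar>a\<bar>)) A"
    using lborel_real_affine[OF assms(2), of c] by simp
  also have "\<dots> = ennreal \<bar>a\<bar> * emeasure lborel {x. a * x + c \<in> A}"
    using assms by (simp add: emeasure_density nn_integral_cmult emeasure_distr vimage_def add.commute)
  finally have "measure lborel A = \<bar>a\<bar> * measure lborel {x. a * x + c \<in> A}"
    by (simp add: measure_def enn2real_mult)
  then show ?thesis
    using assms by simp
qed

subsection \<open>Piecewise linear maps along a walk\<close>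

text \<open>The data of a piecewise linear map: breakpoints \<open>t i\<close> and heights
  \<open>v i / 2 ^ m\<close>. The assumption \<open>load\<close> is the discrete form of preserving
  Lebesgue measure.\<close>

locale zigzag =
  fixes n m :: nat and t :: "nat \<Rightarrow> real" and v :: "nat \<Rightarrow> nat"
  assumes t_0: "t 0 = 0" and t_n: "t n = 1"
    and t_step: "\<And>i. i < n \<Longrightarrow> \<exists>k::int. t (Suc i) - t i = 2 powi k"
    and v_step: "\<And>i. i < n \<Longrightarrow> v (Suc i) = Suc (v i) \<or> v i = Suc (v (Suc i))"
    and v_le: "\<And>i. i \<le> n \<Longrightarrow> v i \<le> 2 ^ m"
    and load: "\<And>j. j < 2 ^ m \<Longrightarrow>
      (\<Sum>i | i < n \<and> min (v i) (v (Suc i)) = j. t (Suc i) - t i) = 1 / 2 ^ m"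
begin

text \<open>
  The interpolation is a sum of clamped steps rather than a case distinction, so that its
  continuity is evident and its values on a piece follow by telescoping.
\<close>
definition G :: "real \<Rightarrow> real" where
  "G x = (v 0 + (\<Sum>i<n. (real (v (Suc i)) - v i) *
     max 0 (min 1 ((x - t i) / (t (Suc i) - t i))))) / 2 ^ m"

definition slope :: "nat \<Rightarrow> real" where
  "slope i = (real (v (Suc i)) - v i) / (t (Suc i) - t i) / 2 ^ m"

definition c :: "nat \<Rightarrow> nat" where
  "c i = min (v i) (v (Suc i))"

lemma t_less: "i < n \<Longrightarrow> t i < t (Suc i)"
  using t_step[of i] by (smt (verit) zero_less_power_int)

lemma t_mono: "i \<le> j \<Longrightarrow> j \<le> n \<Longrightarrow> t i \<le> t j"
  using steps_mono t_less by blast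

lemma t_bounds: "i \<le> n \<Longrightarrow> 0 \<le> t i" "i \<le> n \<Longrightarrow> t i \<le> 1"
  using t_mono[of 0 i] t_mono[of i n] t_0 t_n by auto

lemma n_pos: "0 < n"
  using t_0 t_n by (cases n) auto

lemma c_less: "i < n \<Longrightarrow> c i < 2 ^ m"
  using v_step[of i] v_le[of i] v_le[of "Suc i"] by (auto simp: c_def)

lemma abs_slope: "i < n \<Longrightarrow> \<bar>slope i\<bar> = 1 / ((t (Suc i) - t i) * 2 ^ m)"
  using v_step[of i] t_less[of i] by (auto simp: slope_def field_simps)

lemma slope_nonzero: "i < n \<Longrightarrow> slope i \<noteq> 0"
  using abs_slope[of i] t_less[of i] by auto

lemma abs_slope_powi: "i < n \<Longrightarrow> \<exists>k::int. \<bar>slope i\<bar> = 2 powi k"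
proof -
  assume i: "i < n"
  obtain k :: int where "t (Suc i) - t i = 2 powi k"
    using t_step[OF i] by blast
  then have "\<bar>slope i\<bar> = 2 powi (- k - int m)"
    using abs_slope[OF i] by (simp add: power_int_diff power_int_minus field_simps)
  then show ?thesis by blast
qed

lemma continuous_G: "continuous_on S G"
proof -
  \<comment> \<open>Here \<open>i\<close> is arbitrary, so a piece of length zero can occur;
    division by zero then makes the term constant.\<close>
  have *: "continuous_on S (\<lambda>x. max 0 (min 1 ((x - t i) / (t (Suc i) - t i))))" for i
    by (cases "t (Suc i) = t i") (auto intro!: continuous_intros)
  then show ?thesis
    unfolding G_def
    by (intro continuous_on_divide continuous_on_add continuous_on_sum continuous_on_mult_left
        continuous_on_const *) auto
qed

text \<open>On piece \<open>i\<close> the clamped terms of earlier pieces have reached one and those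
  of later pieces are still zero.\<close>

lemma G_piece:
  assumes "i < n" "t i \<le> x" "x \<le> t (Suc i)"
  shows "G x = v i / 2 ^ m + slope i * (x - t i)"
proof -
  define h where "h j = (real (v (Suc j)) - v j) * max 0 (min 1 ((x - t j) / (t (Suc j) - t j)))" for j
  have "sum h {..<i} = (\<Sum>j<i. real (v (Suc j)) - v j)"
  proof (rule sum.cong)
    fix j assume "j \<in> {..<i}"
    then have "t (Suc j) \<le> x" "t j < t (Suc j)"
      using assms t_mono[of "Suc j" i] t_less[of j] by auto
    then show "h j = real (v (Suc j)) - v j"
      by (simp add: h_def min_def max_def)
  qed simp
  also have "\<dots> = real (v i) - v 0"
    by (rule sum_lessThan_telescope)
  finally have 1: "sum h {..<i} = real (v i) - v 0" .
  have 2: "sum h {Suc i..<n} = 0"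
  proof (intro sum.neutral ballI)
    fix j assume "j \<in> {Suc i..<n}"
    then have "x \<le> t j" "t j < t (Suc j)"
      using assms t_mono[of "Suc i" j] t_less[of j] by auto
    then show "h j = 0"
      by (simp add: h_def divide_nonpos_pos)
  qed
  have "0 \<le> (x - t i) / (t (Suc i) - t i)" "(x - t i) / (t (Suc i) - t i) \<le> 1"
    using assms t_less[of i] by auto
  then have 3: "h i = slope i * (x - t i) * 2 ^ m"
    by (simp add: h_def slope_def)
  have "sum h {..<n} = sum h {..<i} + sum h {i..<n}"
    using assms sum.atLeastLessThan_concat[of 0 i n h] by (simp add: lessThan_atLeast0)
  also have "sum h {i..<n} = h i + sum h {Suc i..<n}"
    using assms by (intro sum.atLeast_Suc_lessThan)
  finally have 4: "sum h {..<n} = sum h {..<i} + (h i + sum h {Suc i..<n})" .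
  then show ?thesis
    unfolding G_def h_def[symmetric] 4 1 2 3 by (simp add: field_simps)
qed

lemma G_t: "i \<le> n \<Longrightarrow> G (t i) = v i / 2 ^ m"
proof -
  assume "i \<le> n"
  then consider "i < n" | k where "i = Suc k" "k < n"
    using n_pos by (cases i) auto
  then show ?thesis
  proof cases
    case 1
    then show ?thesis
      using G_piece[of i "t i"] t_less[of i] by simp
  next
    case 2
    have "slope k * (t (Suc k) - t k) = (real (v (Suc k)) - v k) / 2 ^ m"
      using t_less[OF 2(2)] by (simp add: slope_def)
    then show ?thesis
      using G_piece[of k "t i"] t_less[OF 2(2)] 2 by (simp add: diff_divide_distrib)
  qed
qed

text \<open>Since the height changes by one grid unit, the line through piece \<open>i\<close> maps
  this piece bijectively onto its cell. The affine formula replaces \<open>G x\<close> so that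
  \<open>x\<close> may be any real number.\<close>

lemma in_cell_iff:
  assumes i: "i < n" and y: "y = v i / 2 ^ m + slope i * (x - t i)"
  shows "c i / 2 ^ m < y \<and> y < Suc (c i) / 2 ^ m \<longleftrightarrow> t i < x \<and> x < t (Suc i)"
    and "c i / 2 ^ m \<le> y \<and> y \<le> Suc (c i) / 2 ^ m \<longleftrightarrow> t i \<le> x \<and> x \<le> t (Suc i)"
proof -
  \<comment> \<open>The relative position in the piece: \<open>y\<close> runs through the cell,
    upwards or downwards, as \<open>z\<close> runs from 0 to 1.\<close>
  define z where "z = (x - t i) / (t (Suc i) - t i)"
  have z: "0 < z \<longleftrightarrow> t i < x" "z < 1 \<longleftrightarrow> x < t (Suc i)" "0 \<le> z \<longleftrightarrow> t i \<le> x" "z \<le> 1 \<longleftrightarrow> x \<le> t (Suc i)"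
    using t_less[OF i] by (auto simp: z_def field_simps)
  have y: "y = (v i + (real (v (Suc i)) - v i) * z) / 2 ^ m"
    unfolding y slope_def z_def by (simp add: add_divide_distrib)
  show "c i / 2 ^ m < y \<and> y < Suc (c i) / 2 ^ m \<longleftrightarrow> t i < x \<and> x < t (Suc i)"
    "c i / 2 ^ m \<le> y \<and> y \<le> Suc (c i) / 2 ^ m \<longleftrightarrow> t i \<le> x \<and> x \<le> t (Suc i)"
    using v_step[OF i] unfolding z[symmetric] y by (auto simp: c_def divide_less_cancel divide_le_cancel)
qed

lemma piece_of:
  assumes "x \<in> {0..1}"
  obtains i where "i < n" "t i \<le> x" "x \<le> t (Suc i)"
  using steps_cover_closed[of t x n] assms t_0 t_n n_pos by auto

lemma G_cell:
  assumes "i < n" "t i \<le> x" "x \<le> t (Suc i)"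
  shows "c i / 2 ^ m \<le> G x" "G x \<le> Suc (c i) / 2 ^ m"
  using in_cell_iff(2)[OF assms(1) G_piece[OF assms]] assms by auto

lemma G_range: "x \<in> {0..1} \<Longrightarrow> G x \<in> {0..1}"
proof -
  assume "x \<in> {0..1}"
  then obtain i where i: "i < n" "t i \<le> x" "x \<le> t (Suc i)"
    by (rule piece_of)
  have "real (Suc (c i)) \<le> 2 ^ m"
    using c_less[OF i(1)] by (metis Suc_leI of_nat_le_iff of_nat_numeral of_nat_power)
  then have "Suc (c i) / 2 ^ m \<le> (1::real)"
    by simp
  moreover have "0 \<le> c i / (2::real) ^ m" by simp
  ultimately show ?thesis
    using G_cell[OF i] by (metis atLeastAtMost_iff order_trans)
qed

text \<open>Positive load forces every cell to be crossed. The lowest cell yields the value 0, the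
  highest the value 1, and connectedness the values in between.\<close>

lemma G_image: "G ` {0..1} = {0..1}"
proof
  show "G ` {0..1} \<subseteq> {0..1}"
    using G_range by blast
  have hit: "\<exists>i<n. c i = j" if "j < 2 ^ m" for j
  proof (rule ccontr)
    assume "\<not> ?thesis"
    then have "{i. i < n \<and> min (v i) (v (Suc i)) = j} = {}"
      unfolding c_def by blast
    then have "(1::real) / 2 ^ m = 0"
      using load[OF that] by (metis sum.empty)
    then show False by simp
  qed
  obtain i where i: "i < n" "c i = 0"
    using hit[of 0] by auto
  then have "v i = 0 \<or> v (Suc i) = 0"
    by (auto simp: c_def min_def split: if_splits)
  then obtain i' where i': "i' \<le> n" "v i' = 0"
    using i(1) less_imp_le[OF i(1)] Suc_leI[OF i(1)] by metis
  have p: "t i' \<in> {0..1}" "G (t i') = 0"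
    using G_t[OF i'(1)] i'(2) t_bounds[OF i'(1)] by simp_all
  obtain k where k: "k < n" "c k = 2 ^ m - 1"
    using hit[of "2 ^ m - 1"] by auto
  then have "Suc (c k) = 2 ^ m"
    by simp
  moreover have "v k = Suc (c k) \<or> v (Suc k) = Suc (c k)"
    using v_step[OF k(1)] unfolding c_def by linarith
  ultimately have "v k = 2 ^ m \<or> v (Suc k) = 2 ^ m"
    by metis
  then obtain k' where k': "k' \<le> n" "v k' = 2 ^ m"
    using k(1) less_imp_le[OF k(1)] Suc_leI[OF k(1)] by metis
  have q: "t k' \<in> {0..1}" "G (t k') = 1"
    using G_t[OF k'(1)] k'(2) t_bounds[OF k'(1)] by simp_all
  have "connected (G ` {0..1})"
    by (intro connected_continuous_image continuous_G) simp
  then show "{0..1} \<subseteq> G ` {0..1}"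
    using connected_contains_Icc[of "G ` {0..1}" 0 1] p q by (metis imageI)
qed

text \<open>Piece \<open>i\<close> contributes the measure of \<open>A\<close> in its cell divided
  by the absolute slope. Grouping the pieces by cell, the factors over each cell sum to one by
  \<open>load\<close>.\<close>

lemma measure_G_vimage:
  assumes A: "A \<in> sets borel" "A \<subseteq> {0..1}"
  shows "measure lborel ({0..1} \<inter> G -` A) = measure lborel A"
proof -
  define cells where "cells j = {real j / 2 ^ m<..<real (Suc j) / 2 ^ m}" for j
  have G[measurable]: "G \<in> borel_measurable borel"
    using continuous_G by (rule borel_measurable_continuous_onI)
  have pieceA: "measure lborel A = (\<Sum>j<2 ^ m. measure lborel (A \<inter> cells j))"
    unfolding cells_def
    by (rule measure_subintervals[OF A, of "\<lambda>j. real j / 2 ^ m"]) (auto simp: divide_strict_right_mono)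
  have "{0..1} \<inter> G -` A \<in> sets borel"
    using measurable_sets[OF G A(1)] by simp
  then have "measure lborel ({0..1} \<inter> G -` A) =
      (\<Sum>i<n. measure lborel ({0..1} \<inter> G -` A \<inter> {t i<..<t (Suc i)}))"
    by (rule measure_subintervals) (auto simp: t_0 t_n t_less)
  also have "\<dots> = (\<Sum>i<n. (t (Suc i) - t i) * 2 ^ m * measure lborel (A \<inter> cells (c i)))"
  proof (intro sum.cong refl)
    fix i assume "i \<in> {..<n}"
    then have i: "i < n" by simp
    define d where "d = v i / 2 ^ m - slope i * t i"
    \<comment> \<open>Meeting the open cell already confines \<open>x\<close> to the open piece, so
      the preimage can be taken under an affine map of the whole line.\<close>
    have "{0..1} \<inter> G -` A \<inter> {t i<..<t (Suc i)} = {x. slope i * x + d \<in> A \<inter> cells (c i)}"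
    proof -
      have "x \<in> {0..1} \<inter> G -` A \<inter> {t i<..<t (Suc i)} \<longleftrightarrow> slope i * x + d \<in> A \<inter> cells (c i)" for x
      proof -
        have "slope i * x + d = v i / 2 ^ m + slope i * (x - t i)"
          by (simp add: d_def algebra_simps)
        then show ?thesis
          using in_cell_iff(1)[OF i, of "slope i * x + d" x] G_piece[OF i, of x]
            t_bounds(1)[of i] t_bounds(2)[of "Suc i"] i
          by (auto simp: cells_def)
      qed
      then show ?thesis by blast
    qed
    then show "measure lborel ({0..1} \<inter> G -` A \<inter> {t i<..<t (Suc i)}) =
        (t (Suc i) - t i) * 2 ^ m * measure lborel (A \<inter> cells (c i))"
      using measure_affine_vimage[of "A \<inter> cells (c i)" "slope i" d] A slope_nonzero[OF i] abs_slope[OF i]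
      by (simp add: cells_def)
  qed
  also have "\<dots> = (\<Sum>j<2 ^ m. \<Sum>i | i \<in> {..<n} \<and> c i = j.
      (t (Suc i) - t i) * 2 ^ m * measure lborel (A \<inter> cells (c i)))"
    using c_less by (intro sum.group[symmetric]) auto
  also have "\<dots> = (\<Sum>j<2 ^ m. measure lborel (A \<inter> cells j))"
  proof (intro sum.cong refl)
    fix j :: nat assume "j \<in> {..<2 ^ m}"
    then have "(\<Sum>i | i < n \<and> c i = j. t (Suc i) - t i) = 1 / 2 ^ m"
      using load[of j] by (simp add: c_def)
    then show "(\<Sum>i | i \<in> {..<n} \<and> c i = j. (t (Suc i) - t i) * 2 ^ m * measure lborel (A \<inter> cells (c i)))
        = measure lborel (A \<inter> cells j)"
      by (simp add: sum_distrib_right[symmetric])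
  qed
  finally show ?thesis
    using pieceA by simp
qed

definition g :: "real \<Rightarrow> real" where
  "g = restrict G {0..1}"

lemma g_eq: "x \<in> {0..1} \<Longrightarrow> g x = G x"
  by (simp add: g_def)

lemma dyadic_t: "i \<le> n \<Longrightarrow> dyadic (t i)"
proof (induction i)
  case (Suc i)
  then show ?case
    using t_step[of i] dyadic_add[of "t i" "t (Suc i) - t i"] dyadic_powi by auto
qed (simp add: t_0 dyadic_0)

lemma g_piece:
  assumes "i < n" "x \<in> {t i..t (Suc i)}"
  shows "g x = slope i * x + (v i / 2 ^ m - slope i * t i)"
proof -
  have "x \<in> {0..1}"
    using assms t_bounds[of i] t_bounds[of "Suc i"] by auto
  then show ?thesis
    using G_piece[of i x] assms by (simp add: g_eq algebra_simps)
qed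

text \<open>A derivative within \<open>{0..1}\<close> is also one within a closed piece containing
  \<open>x\<close>, where \<open>g\<close> is affine; the piece is nondegenerate, so derivatives are
  unique. This covers breakpoints and endpoints as well.\<close>

lemma g_deriv_unique:
  assumes "x \<in> {0..1}" "(g has_real_derivative d) (at x within {0..1})"
  shows "\<exists>i<n. d = slope i"
proof -
  obtain i where i: "i < n" "t i \<le> x" "x \<le> t (Suc i)"
    using assms(1) by (rule piece_of)
  have "{t i..t (Suc i)} \<subseteq> {0..1}"
    using i(1) t_bounds[of i] t_bounds[of "Suc i"] by auto
  with assms(2) have "(g has_real_derivative d) (at x within {t i..t (Suc i)})"
    by (rule has_field_derivative_subset)
  moreover have "(g has_real_derivative slope i) (at x within {t i..t (Suc i)})"
  proof (rule has_field_derivative_transform_within[OF _ zero_less_one])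
    show "((\<lambda>x. slope i * x + (v i / 2 ^ m - slope i * t i)) has_real_derivative slope i)
        (at x within {t i..t (Suc i)})"
      by (auto intro!: derivative_eq_intros)
  qed (use i g_piece in auto)
  moreover have "at x within {t i..t (Suc i)} \<noteq> bot"
    using i t_less[of i] by (simp add: trivial_limit_within islimpt_Icc)
  ultimately have "d = slope i"
    using has_field_derivative_unique by blast
  with i show ?thesis by blast
qed

text \<open>Off the breakpoints, \<open>g\<close> is affine near \<open>x\<close>. The inclusion can
  be strict, as adjacent pieces may have equal slopes.\<close>

lemma nondiff_g: "nondiff_points g \<subseteq> t ` {..n}"
proof
  fix x assume "x \<in> nondiff_points g"
  then have x: "x \<in> {0..1}" and nd: "\<not> g differentiable (at x within {0..1})"
    by (auto simp: nondiff_points_def)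
  show "x \<in> t ` {..n}"
  proof (rule ccontr)
    assume "x \<notin> t ` {..n}"
    then obtain i where i: "i < n" "t i < x" "x < t (Suc i)"
      using steps_cover[of t x n] x t_0 t_n by auto
    have "(g has_real_derivative slope i) (at x)"
    proof (rule has_field_derivative_transform_within_open[of _ _ _ "{t i<..<t (Suc i)}"])
      show "((\<lambda>x. slope i * x + (v i / 2 ^ m - slope i * t i)) has_real_derivative slope i) (at x)"
        by (auto intro!: derivative_eq_intros)
    qed (use i g_piece in auto)
    then show False
      using nd by (meson has_field_derivative_at_within real_differentiable_def)
  qed
qed

lemma g_in_G_monoid: "g \<in> G_monoid"
proof -
  have "continuous_on {0..1} g"
    by (rule continuous_on_eq[OF continuous_G]) (simp add: g_eq)
  moreover have "g ` {0..1} = {0..1}"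
    using G_image by (simp add: g_def)
  moreover have "lambda_preserving g"
    unfolding lambda_preserving_def
  proof (intro ballI impI)
    fix A :: "real set"
    assume A: "A \<in> sets borel" "A \<subseteq> {0..1}"
    have G: "G \<in> borel_measurable borel"
      using continuous_G by (rule borel_measurable_continuous_onI)
    have eq: "g -` A \<inter> {0..1} = {0..1} \<inter> G -` A"
      by (auto simp: g_def)
    have B: "{0..1} \<inter> G -` A \<in> sets borel"
      using measurable_sets[OF G A(1)] by simp
    \<comment> \<open>On Borel subsets of the unit interval both measures agree and are finite, so
      real-valued measures can be compared.\<close>
    have em: "emeasure (lebesgue_on {0..1}) B = ennreal (measure lborel B)"
      if "B \<in> sets borel" "B \<subseteq> {0..1::real}" for B
      using that fmeasurable_unit[OF that] by (simp add: emeasure_restrict_space emeasure_eq_measure2)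
    show "emeasure (lebesgue_on {0..1}) A = emeasure (lebesgue_on {0..1}) (g -` A \<inter> {0..1})"
      unfolding eq em[OF A] using em[OF B] measure_G_vimage[OF A] by simp
  qed
  moreover have "piecewise_affine g"
    unfolding piecewise_affine_def
    using t_0 t_n t_less g_piece by (intro exI[of _ n] exI[of _ t]) blast
  moreover have "finite (nondiff_points g)" "\<forall>x\<in>nondiff_points g. dyadic x"
    using nondiff_g dyadic_t by (auto intro: finite_subset)
  moreover have "g \<in> {0..1} \<rightarrow>\<^sub>E {0..1}"
    using G_range by (auto simp: g_def)
  moreover have "\<exists>k::int. \<bar>d\<bar> = 2 powi k"
    if "x \<in> {0..1}" "(g has_real_derivative d) (at x within {0..1})" for x d
    using g_deriv_unique[OF that] abs_slope_powi by blast
  ultimately show ?thesis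
    unfolding G_monoid_def by blast
qed

end

section \<open>From walks to maps in \<open>G_monoid\<close>\<close>

abbreviation vertices :: "step list \<Rightarrow> nat \<Rightarrow> nat list" where
  "vertices xs u' \<equiv> map fst xs @ [u']"

lemma vertices_0: "walk u xs u' \<Longrightarrow> vertices xs u' ! 0 = u"
  by (cases xs) auto

text \<open>Turns the recursive description of a walk into the indexed conditions of the locale
  \<open>zigzag\<close>.\<close>

lemma walk_nth:
  assumes "walk u xs u'" "i < length xs"
  defines "v \<equiv> \<lambda>i. vertices xs u' ! i"
  shows "cell (xs ! i) = min (v i) (v (Suc i))"
    and "v (Suc i) = Suc (v i) \<or> v i = Suc (v (Suc i))"
    and "\<exists>k::int. time (xs ! i) = 2 powi k"
proof -
  have "cell (xs ! i) = min (vertices xs u' ! i) (vertices xs u' ! Suc i) \<and>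
    (vertices xs u' ! Suc i = Suc (vertices xs u' ! i) \<or> vertices xs u' ! i = Suc (vertices xs u' ! Suc i)) \<and>
    (\<exists>k::int. time (xs ! i) = 2 powi k)"
    using assms(1,2)
  proof (induction u xs u' arbitrary: i rule: walk.induct)
    case (2 u v v' w xs u')
    show ?case
    proof (cases i)
      case 0
      then show ?thesis
        using 2 vertices_0[of v' xs u'] by auto
    next
      case (Suc k)
      then show ?thesis
        using 2 by auto
    qed
  qed simp
  then show "cell (xs ! i) = min (v i) (v (Suc i))"
    "v (Suc i) = Suc (v i) \<or> v i = Suc (v (Suc i))"
    "\<exists>k::int. time (xs ! i) = 2 powi k"
    by (simp_all add: v_def)
qed

lemma load_eq_sum:
  "load xs j = (\<Sum>i | i < length xs \<and> cell (xs ! i) = j. time (xs ! i))"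
proof -
  have "load xs j = (\<Sum>i<length xs. if cell (xs ! i) = j then time (xs ! i) else 0)"
    unfolding load_def by (simp add: sum_list_sum_nth lessThan_atLeast0)
  also have "\<dots> = (\<Sum>i | i \<in> {..<length xs} \<and> cell (xs ! i) = j. time (xs ! i))"
    by (rule sum.inter_filter[symmetric]) simp
  finally show ?thesis by simp
qed

lemma duration_take_Suc:
  "k < length xs \<Longrightarrow> duration (take (Suc k) xs) = duration (take k xs) + time (xs ! k)"
  by (simp add: take_Suc_conv_app_nth)

text \<open>The elapsed times and visited grid points of the walk form a \<open>zigzag\<close>. The
  step under way at time \<open>x\<close> confines \<open>g x\<close> to the cell it
  crosses.\<close>

lemma realise_walk:
  assumes walk: "walk u xs u'"
    and load: "\<And>j. j < 2 ^ m \<Longrightarrow> load xs j = 1 / 2 ^ m" "\<And>j. 2 ^ m \<le> j \<Longrightarrow> load xs j = 0"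
  shows "\<exists>g\<in>G_monoid. \<forall>x\<in>{0..1}. \<exists>k<length xs.
    duration (take k xs) \<le> x \<and> x \<le> duration (take (Suc k) xs) \<and>
    cell (xs ! k) / 2 ^ m \<le> g x \<and> g x \<le> Suc (cell (xs ! k)) / 2 ^ m"
proof -
  define v where "v i = vertices xs u' ! i" for i
  define t where "t k = duration (take k xs)" for k
  note step = walk_nth[OF walk, folded v_def]
  \<comment> \<open>Steps take positive time, so a cell with zero load is never crossed.\<close>
  have cell_less: "cell (xs ! i) < 2 ^ m" if "i < length xs" for i
  proof (rule ccontr)
    assume "\<not> ?thesis"
    then have "load xs (cell (xs ! i)) = 0"
      by (intro load(2)) simp
    moreover have "0 < load xs (cell (xs ! i))"
      using that walk_time_pos[OF walk] by (intro load_pos) auto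
    ultimately show False by simp
  qed
  have t_Suc: "t (Suc i) - t i = time (xs ! i)" if "i < length xs" for i
    using duration_take_Suc[OF that] by (simp add: t_def)
  have dur: "duration xs = 1"
  proof -
    have "duration xs = (\<Sum>j<2 ^ m. load xs j)"
      using cell_less by (intro duration_eq_sum_load) (metis in_set_conv_nth)
    also have "\<dots> = (\<Sum>j<(2::nat) ^ m. 1 / 2 ^ m)"
      using load(1) by (intro sum.cong) auto
    finally show ?thesis by simp
  qed
  then have len: "0 < length xs"
    by (cases xs) auto
  interpret zigzag "length xs" m t v
  proof
    show "t 0 = 0" "t (length xs) = 1"
      using dur by (simp_all add: t_def)
    fix i assume "i < length xs"
    then show "\<exists>k::int. t (Suc i) - t i = 2 powi k" "v (Suc i) = Suc (v i) \<or> v i = Suc (v (Suc i))"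
      using t_Suc step by simp_all
  next
    fix i assume i: "i \<le> length xs"
    \<comment> \<open>Every grid point visited is an end of some step, whose cell lies below
      \<open>2 ^ m\<close>; the walk is nonempty, so this includes the first one.\<close>
    have "v k \<le> 2 ^ m \<and> v (Suc k) \<le> 2 ^ m" if "k < length xs" for k
      using cell_less[OF that] step(1,2)[OF that] by auto
    then show "v i \<le> 2 ^ m"
      using i len by (cases i) auto
  next
    fix j :: nat assume "j < 2 ^ m"
    have "(\<Sum>i | i < length xs \<and> min (v i) (v (Suc i)) = j. t (Suc i) - t i) = load xs j"
      unfolding load_eq_sum using step(1) t_Suc by (intro sum.cong) auto
    then show "(\<Sum>i | i < length xs \<and> min (v i) (v (Suc i)) = j. t (Suc i) - t i) = 1 / 2 ^ m"
      using load(1)[OF \<open>j < 2 ^ m\<close>] by simp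
  qed
  show ?thesis
  proof (rule bexI[OF _ g_in_G_monoid], rule ballI)
    fix x :: real assume x: "x \<in> {0..1}"
    then obtain k where k: "k < length xs" "t k \<le> x" "x \<le> t (Suc k)"
      by (rule piece_of)
    then show "\<exists>k<length xs. duration (take k xs) \<le> x \<and> x \<le> duration (take (Suc k) xs) \<and>
      cell (xs ! k) / 2 ^ m \<le> g x \<and> g x \<le> Suc (cell (xs ! k)) / 2 ^ m"
      using G_cell[OF k] g_eq[OF x] step(1)[OF k(1)]
      by (intro exI[of _ k]) (simp add: t_def c_def)
  qed
qed

subsection \<open>Cell masses of a measure-preserving map\<close>

text \<open>
  The map is extended continuously to the whole line, so that preimages of Borel sets are Borel
  and preimages of open sets are open.
\<close>
locale preserving =
  fixes f :: "real \<Rightarrow> real" and N K :: nat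
  assumes cont: "continuous_on UNIV f"
    and range: "\<And>x. x \<in> {0..1} \<Longrightarrow> f x \<in> {0..1}"
    and preserves: "\<And>A. A \<in> sets borel \<Longrightarrow> A \<subseteq> {0..1} \<Longrightarrow>
      measure lborel ({0..1} \<inter> f -` A) = measure lborel A"
    and N: "0 < N" and K: "0 < K"
begin

definition I :: "nat \<Rightarrow> real set" where
  "I i = {real i / N<..<real (Suc i) / N}"

definition J :: "nat \<Rightarrow> real set" where
  "J j = {real j / K<..<real (Suc j) / K}"

definition mass :: "nat \<Rightarrow> nat \<Rightarrow> real" where
  "mass i j = measure lborel (I i \<inter> f -` J j)"

lemma f_borel: "f \<in> borel_measurable borel"
  using cont by (rule borel_measurable_continuous_onI)

lemma vimage_borel: "A \<in> sets borel \<Longrightarrow> f -` A \<in> sets borel"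
  using measurable_sets[OF f_borel, of A] by simp

lemma grid_unit:
  assumes "j < n"
  shows "0 \<le> real j / n" "real (Suc j) / n \<le> 1" "real j / n < real (Suc j) / n"
  using assms by (auto simp: divide_simps)

lemma I_unit: "i < N \<Longrightarrow> {real i / N..real (Suc i) / N} \<subseteq> {0..1}" "i < N \<Longrightarrow> I i \<subseteq> {0..1}"
  using grid_unit(1,2)[of i N]
  unfolding I_def subset_iff atLeastAtMost_iff greaterThanLessThan_iff
  by (meson less_imp_le order_trans)+

lemma J_unit: "j < K \<Longrightarrow> J j \<subseteq> {0..1}"
  using grid_unit(1,2)[of j K]
  unfolding J_def subset_iff atLeastAtMost_iff greaterThanLessThan_iff
  by (meson less_imp_le order_trans)

text \<open>By invariance the fibre over \<open>y\<close> has the measure of a single point; outside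
  the unit interval it is empty.\<close>

lemma measure_fibre: "B \<subseteq> {0..1} \<Longrightarrow> B \<in> sets borel \<Longrightarrow> measure lborel (B \<inter> f -` {y}) = 0"
proof (cases "y \<in> {0..1}")
  assume B: "B \<subseteq> {0..1}" "B \<in> sets borel"
  case True
  have "measure lborel (B \<inter> f -` {y}) \<le> measure lborel ({0..1} \<inter> f -` {y})"
    using B vimage_borel[of "{y}"] by (intro measure_mono_fmeasurable fmeasurable_unit) auto
  also have "\<dots> = measure lborel {y}"
    using True by (intro preserves) auto
  finally show ?thesis
    by (simp add: measure_le_0_iff)
next
  assume "B \<subseteq> {0..1}"
  case False
  then have "B \<inter> f -` {y} = {}"
    using range \<open>B \<subseteq> {0..1}\<close> by blast
  then show ?thesis by simp
qed

text \<open>This is invariance applied to the cell \<open>J j\<close>, whose preimage is cut by the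
  intervals \<open>I i\<close>.\<close>

lemma mass_col:
  assumes "j < K"
  shows "(\<Sum>i<N. mass i j) = 1 / K"
proof -
  define B where "B = {0..1} \<inter> f -` J j"
  have "B \<in> sets borel"
    unfolding B_def using vimage_borel[of "J j"] by (simp add: J_def)
  then have "measure lborel B = (\<Sum>i<N. measure lborel (B \<inter> {real i / N<..<real (Suc i) / N}))"
    using N by (intro measure_subintervals) (auto simp: B_def divide_strict_right_mono)
  moreover have "B \<inter> {real i / N<..<real (Suc i) / N} = I i \<inter> f -` J j" if "i < N" for i
    using I_unit(2)[OF that] unfolding B_def I_def by blast
  moreover have "measure lborel B = measure lborel (J j)"
    unfolding B_def using J_unit[OF assms] by (intro preserves) (auto simp: J_def)
  ultimately show ?thesis
    using K by (simp add: mass_def J_def diff_divide_distrib[symmetric] divide_right_mono)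
qed

lemma mass_row:
  assumes "i < N"
  shows "(\<Sum>j<K. mass i j) = 1 / N"
proof -
  have I: "I i \<in> sets borel" "I i \<subseteq> {0..1}"
    using I_unit[OF assms] by (simp_all add: I_def)
  have "measure lborel (I i) = (\<Sum>j<K. measure lborel (I i \<inter> f -` {real j / K<..<real (Suc j) / K}))"
  proof (rule measure_pieces[OF fmeasurable_unit[OF I] f_borel])
    fix x assume "x \<in> I i"
    then have "x \<in> {0..1}" using I by blast
    then show "real 0 / K \<le> f x \<and> f x \<le> real K / K"
      using range[of x] K by simp
  qed (use I measure_fibre K in \<open>auto simp: divide_strict_right_mono\<close>)
  then show ?thesis
    using N by (simp add: mass_def J_def I_def diff_divide_distrib[symmetric] divide_right_mono)
qed

lemma mass_nonneg: "0 \<le> mass i j"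
  by (simp add: mass_def)

lemma mass_pos_obtains:
  assumes "0 < mass i j"
  obtains x where "x \<in> I i" "f x \<in> J j"
  using assms unfolding mass_def
  by (metis Int_iff equals0I less_irrefl measure_empty vimage_eq)

text \<open>The image of the closed interval is some \<open>{lo..hi}\<close>, and cell
  \<open>j\<close> has positive mass exactly if it meets the interior of this image. The bounds on
  \<open>nat \<lfloor>K * f x\<rfloor>\<close> cover the endpoints of the interval, where
  consecutive rows meet.\<close>

lemma mass_support:
  assumes "i < N"
  shows "\<exists>a e. e \<le> K \<and> (\<forall>j. 0 < mass i j \<longleftrightarrow> a \<le> j \<and> j < e) \<and>
    (\<forall>x\<in>{real i / N..real (Suc i) / N}. a \<le> nat \<lfloor>K * f x\<rfloor> \<and> nat \<lfloor>K * f x\<rfloor> \<le> e)"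
proof -
  let ?I = "{real i / N..real (Suc i) / N}"
  have less: "real i / N < real (Suc i) / N"
    using grid_unit(3)[OF assms] .
  obtain lo hi where img: "f ` ?I = {lo..hi}" "lo \<le> hi"
    using continuous_image_closed_interval[of "real i / N" "real (Suc i) / N" f] less
      continuous_on_subset[OF cont] by auto
  have bounds: "0 \<le> lo" "hi \<le> 1"
    using range I_unit(1)[OF assms] img by (auto simp: subset_iff dest!: equalityD2)
  have in_img: "lo \<le> f x \<and> f x \<le> hi" if "x \<in> ?I" for x
    using img(1) that by (metis atLeastAtMost_iff imageI)
  \<comment> \<open>Otherwise the whole interval would lie in a single fibre, which is null.\<close>
  have "lo < hi"
  proof (rule ccontr)
    assume "\<not> lo < hi"
    then have "f x = lo" if "x \<in> ?I" for x
      using in_img[OF that] by simp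
    then have "I i \<inter> f -` {lo} = I i"
      by (auto simp: I_def)
    then have "measure lborel (I i) = 0"
      using measure_fibre[of "I i" lo] I_unit(2)[OF assms] by (simp add: I_def)
    then show False
      using less by (simp add: I_def)
  qed
  \<comment> \<open>The right-hand side says that \<open>J j\<close> meets the open interval from
    \<open>lo\<close> to \<open>hi\<close>.\<close>
  have pos: "0 < mass i j \<longleftrightarrow> K * lo < real j + 1 \<and> real j < K * hi" for j
  proof
    assume "0 < mass i j"
    then obtain x where x: "x \<in> I i" "f x \<in> J j"
      by (rule mass_pos_obtains)
    then have "lo \<le> f x" "f x \<le> hi" "real j < K * f x" "K * f x < real j + 1"
      using in_img[of x] K by (auto simp: I_def J_def field_simps)
    moreover have "K * lo \<le> K * f x" "K * f x \<le> K * hi"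
      using \<open>lo \<le> f x\<close> \<open>f x \<le> hi\<close> by (auto intro: mult_left_mono)
    ultimately show "K * lo < real j + 1 \<and> real j < K * hi"
      by linarith
  next
    assume j: "K * lo < real j + 1 \<and> real j < K * hi"
    define U where "U = {max lo (real j / K)<..<min hi (real (Suc j) / K)}"
    have "max lo (real j / K) < min hi (real (Suc j) / K)"
      using j \<open>lo < hi\<close> K by (auto simp: field_simps)
    then obtain y where y: "y \<in> U"
      unfolding U_def using dense by (metis greaterThanLessThan_iff)
    then have "y \<in> {lo..hi}"
      by (simp add: U_def)
    then obtain x where x: "x \<in> ?I" "f x = y"
      unfolding img(1)[symmetric] by blast
    have op: "open (f -` U)"
      using cont by (simp add: U_def open_vimage)
    \<comment> \<open>The point \<open>x\<close> might be an endpoint of the interval; as the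
      preimage of \<open>U\<close> is open, it then also meets the open interval.\<close>
    have "closure (I i) = ?I"
      using less by (simp add: I_def closure_greaterThanLessThan)
    then have "f -` U \<inter> closure (I i) \<noteq> {}"
      using x y by blast
    then have "I i \<inter> f -` U \<noteq> {}"
      using open_Int_closure_eq_empty[OF op] by blast
    moreover have "open (I i \<inter> f -` U)"
      using op by (simp add: I_def open_Int)
    ultimately have "\<not> negligible (I i \<inter> f -` U)"
      by (rule open_not_negligible[rotated])
    moreover have borel: "I i \<inter> f -` U \<in> sets borel"
      using \<open>open (I i \<inter> f -` U)\<close> by simp
    moreover have "I i \<inter> f -` U \<subseteq> {0..1}"
      using I_unit(2)[OF assms] by blast
    ultimately have "measure lborel (I i \<inter> f -` U) \<noteq> 0"
      using emeasure_eq_measure2[OF fmeasurable_unit, of "I i \<inter> f -` U"]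
      by (auto simp: negligible_iff_null_sets null_sets_def)
    moreover have "measure lborel (I i \<inter> f -` U) \<le> mass i j"
      unfolding mass_def
    proof (intro measure_mono_fmeasurable fmeasurable_unit)
      show "I i \<inter> f -` U \<subseteq> I i \<inter> f -` J j"
        by (auto simp: U_def J_def)
      show "I i \<inter> f -` J j \<in> sets borel"
        using vimage_borel[of "J j"] by (simp add: I_def J_def)
    qed (use borel I_unit(2)[OF assms] in auto)
    ultimately show "0 < mass i j"
      using measure_nonneg[of lborel "I i \<inter> f -` U"] by linarith
  qed
  \<comment> \<open>Rounding \<open>K * lo\<close> down and \<open>K * hi\<close> up gives the grid
    points that bound the cells met by the image.\<close>
  show ?thesis
  proof (rule exI[of _ "nat \<lfloor>K * lo\<rfloor>"], rule exI[of _ "nat \<lceil>K * hi\<rceil>"], intro conjI allI ballI)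
    have "K * hi \<le> K"
      using bounds by (simp add: mult_left_le)
    then show "nat \<lceil>K * hi\<rceil> \<le> K"
      by (simp add: ceiling_le_iff nat_le_iff)
    show "0 < mass i j \<longleftrightarrow> nat \<lfloor>K * lo\<rfloor> \<le> j \<and> j < nat \<lceil>K * hi\<rceil>" for j
      unfolding pos by (simp add: nat_le_iff floor_le_iff zless_nat_eq_int_zless less_ceiling_iff)
    fix x assume "x \<in> ?I"
    then have "K * lo \<le> K * f x" "K * f x \<le> K * hi"
      using in_img by (auto intro!: mult_left_mono)
    moreover have "\<lfloor>K * hi\<rfloor> \<le> \<lceil>K * hi\<rceil>"
      by (rule floor_le_ceiling)
    ultimately show "nat \<lfloor>K * lo\<rfloor> \<le> nat \<lfloor>K * f x\<rfloor>" "nat \<lfloor>K * f x\<rfloor> \<le> nat \<lceil>K * hi\<rceil>"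
      using floor_mono order_trans by (blast intro!: nat_mono)+
  qed
qed

end

section \<open>Dyadic masses and the approximating map\<close>

text \<open>Carries invariance from \<open>b\<close>, stated with \<open>lebesgue_on\<close>, to a
  Borel extension \<open>f\<close> and \<open>lborel\<close>, as the locale
  \<open>preserving\<close> requires.\<close>

lemma measure_vimage_of_C_lambda:
  assumes "b \<in> C_lambda" "A \<in> sets borel" "A \<subseteq> {0..1}"
    and "f \<in> borel_measurable borel" and eq: "\<And>x. x \<in> {0..1} \<Longrightarrow> f x = b x"
  shows "measure lborel ({0..1} \<inter> f -` A) = measure lborel A"
proof -
  have "{0..1} \<inter> f -` A = b -` A \<inter> {0..1}"
    using eq by auto
  then have "emeasure (lebesgue_on {0..1}) A = emeasure (lebesgue_on {0..1}) ({0..1} \<inter> f -` A)"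
    using assms(1-3) unfolding C_lambda_def lambda_preserving_def by simp
  moreover have "{0..1} \<inter> f -` A \<in> sets borel"
    using measurable_sets[OF assms(4,2)] by simp
  ultimately have "emeasure lborel A = emeasure lborel ({0..1} \<inter> f -` A)"
    using assms(2,3) by (simp add: emeasure_restrict_space)
  then show ?thesis
    by (simp add: measure_def)
qed

text \<open>
  Only the column sums are preserved exactly: they encode invariance of Lebesgue measure, whereas
  an error in the row sums merely shifts the approximating map in time.
\<close>
lemma (in preserving) dyadic_masses:
  assumes K2: "K = 2 ^ m" and \<eta>: "0 < \<eta>"
  obtains P where
    "\<And>i j. i < N \<Longrightarrow> j < K \<Longrightarrow> 0 < mass i j \<Longrightarrow> dyadic (P i j) \<and> 0 < P i j"
    "\<And>i j. \<not> (i < N \<and> j < K \<and> 0 < mass i j) \<Longrightarrow> P i j = 0"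
    "\<And>i j. i < N \<Longrightarrow> j < K \<Longrightarrow> \<bar>P i j - mass i j\<bar> \<le> \<eta>"
    "\<And>j. j < K \<Longrightarrow> (\<Sum>i<N. P i j) = 1 / K"
proof -
  \<comment> \<open>Only positive masses are rounded, so that the support of each row remains a
    block of consecutive cells.\<close>
  define S where "S j = {i. i < N \<and> 0 < mass i j}" for j
  have sumS: "sum (\<lambda>i. mass i j) (S j) = 1 / K" if "j < K" for j
  proof -
    have "sum (\<lambda>i. mass i j) (S j) = (\<Sum>i<N. mass i j)"
    proof (rule sum.mono_neutral_left)
      have "mass i j = 0" if "\<not> 0 < mass i j" for i
        using that mass_nonneg[of i j] by linarith
      then show "\<forall>i\<in>{..<N} - S j. mass i j = 0"
        by (simp add: S_def)
    qed (auto simp: S_def)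
    then show ?thesis
      using mass_col[OF that] by simp
  qed
  have "\<exists>p. (\<forall>i\<in>S j. dyadic (p i) \<and> 0 < p i \<and> \<bar>p i - mass i j\<bar> < \<eta>) \<and> sum p (S j) = 1 / K"
    if "j < K" for j
    unfolding sumS[OF that, symmetric]
  proof (rule dyadic_rounding)
    show "S j \<noteq> {}"
      using sumS[OF that] K by auto
    \<comment> \<open>The column sum is dyadic because the number of cells is a power of
      two.\<close>
    have "dyadic (1 / 2 ^ m)"
      unfolding dyadic_def by (metis of_int_1)
    then show "dyadic (\<Sum>i\<in>S j. mass i j)"
      using sumS[OF that] K2 by simp
  qed (use \<eta> in \<open>auto simp: S_def\<close>)
  then obtain p where p: "\<And>j i. j < K \<Longrightarrow> i \<in> S j \<Longrightarrow> dyadic (p j i) \<and> 0 < p j i \<and> \<bar>p j i - mass i j\<bar> < \<eta>"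
    "\<And>j. j < K \<Longrightarrow> sum (p j) (S j) = 1 / K"
    by metis
  define P where "P i j = (if i < N \<and> j < K \<and> 0 < mass i j then p j i else 0)" for i j
  show ?thesis
  proof (rule that[of P])
    fix i j assume ij: "i < N" "j < K"
    show "\<bar>P i j - mass i j\<bar> \<le> \<eta>"
      using p(1)[of j i] ij mass_nonneg[of i j] \<eta> by (auto simp: P_def S_def less_imp_le)
  next
    fix j assume j: "j < K"
    have "(\<Sum>i<N. P i j) = sum (p j) (S j)"
      using j by (intro sum.mono_neutral_cong_right) (auto simp: S_def P_def)
    then show "(\<Sum>i<N. P i j) = 1 / K"
      using p(2)[OF j] by simp
  qed (use p(1) in \<open>auto simp: P_def S_def\<close>)
qed

theorem theorem5:
  shows "G_monoid \<subseteq> C_lambda \<and>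
    (\<forall>b\<in>C_lambda. \<forall>\<epsilon>>0. \<exists>g\<in>G_monoid. rho b g < \<epsilon>)"
proof (intro conjI ballI allI impI)
  show "G_monoid \<subseteq> C_lambda"
    unfolding G_monoid_def C_lambda_def by blast
  fix b and \<epsilon> :: real
  assume b: "b \<in> C_lambda" and \<epsilon>: "0 < \<epsilon>"
  define f where "f x = b (max 0 (min 1 x))" for x
  have f_eq: "f x = b x" if "x \<in> {0..1}" for x
    using that by (simp add: f_def)
  have contb: "continuous_on {0..1} b" and rangeb: "\<And>x. x \<in> {0..1} \<Longrightarrow> b x \<in> {0..1}"
    using b by (auto simp: C_lambda_def)
  have contf: "continuous_on UNIV f"
    unfolding f_def by (rule continuous_on_compose2[OF contb]) (auto intro!: continuous_intros)
  have "uniformly_continuous_on {0..1} b"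
    using contb by (intro compact_uniformly_continuous) auto
  then obtain \<delta> where \<delta>: "0 < \<delta>"
    "\<And>x y. x \<in> {0..1} \<Longrightarrow> y \<in> {0..1} \<Longrightarrow> \<bar>x - y\<bar> < \<delta> \<Longrightarrow> \<bar>b x - b y\<bar> < \<epsilon> / 4"
    unfolding uniformly_continuous_on_def dist_real_def
    by (metis \<epsilon> zero_less_divide_iff zero_less_numeral)
  \<comment> \<open>The \<open>2 / N\<close> allows for the width of an interval and for a time
    drift of at most \<open>1 / N\<close>.\<close>
  obtain N :: nat where N: "0 < N" and N_large: "2 / N < \<delta>"
    using reals_Archimedean2[of "2 / \<delta>"] \<delta>(1)
    by (metis divide_less_eq divide_pos_pos less_trans mult.commute of_nat_0_less_iff zero_less_numeral)
  obtain m where m: "1 / 2 ^ m < \<epsilon> / 4"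
    using real_arch_pow_inv[of "\<epsilon> / 4" "1 / 2"] \<epsilon> by (auto simp: power_one_over)
  define K :: nat where "K = 2 ^ m"
  have K: "0 < K" and real_K: "real K = 2 ^ m"
    by (simp_all add: K_def)
  interpret preserving f N K
  proof
    show "measure lborel ({0..1} \<inter> f -` A) = measure lborel A" if "A \<in> sets borel" "A \<subseteq> {0..1}" for A
      using measure_vimage_of_C_lambda[OF b that _ f_eq] contf
      by (simp add: borel_measurable_continuous_onI)
  qed (use contf f_eq rangeb N K in auto)
  \<comment> \<open>At most \<open>N * K\<close> rounding errors accumulate, so the drift is bounded
    by \<open>N * K * \<eta> = 1 / N\<close>.\<close>
  define \<eta> where "\<eta> = 1 / (real N * real N * K)"
  have "0 < \<eta>"
    using N K by (simp add: \<eta>_def)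
  then obtain P where P:
    "\<And>i j. i < N \<Longrightarrow> j < K \<Longrightarrow> 0 < mass i j \<Longrightarrow> dyadic (P i j) \<and> 0 < P i j"
    "\<And>i j. \<not> (i < N \<and> j < K \<and> 0 < mass i j) \<Longrightarrow> P i j = 0"
    "\<And>i j. i < N \<Longrightarrow> j < K \<Longrightarrow> \<bar>P i j - mass i j\<bar> \<le> \<eta>"
    "\<And>j. j < K \<Longrightarrow> (\<Sum>i<N. P i j) = 1 / K"
    using dyadic_masses[OF K_def] by metis
  \<comment> \<open>The grid point at or just below the value of \<open>f\<close> at
    \<open>i / N\<close>. This point belongs to both adjacent closed intervals, so the walk of one
    row can end, and that of the next begin, at this grid point.\<close>
  define u where "u i = nat \<lfloor>K * f (real i / N)\<rfloor>" for i
  define T where "T i = (\<Sum>i'<i. \<Sum>j<K. P i' j)" for i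
  have connects: "connects (u i) (u (Suc i)) (P i)" if i: "i < N" for i
  proof -
    obtain a e where ae: "e \<le> K" "\<And>j. 0 < mass i j \<longleftrightarrow> a \<le> j \<and> j < e"
      "\<And>x. x \<in> {real i / N..real (Suc i) / N} \<Longrightarrow> a \<le> nat \<lfloor>K * f x\<rfloor> \<and> nat \<lfloor>K * f x\<rfloor> \<le> e"
      using mass_support[OF i] by blast
    have "real i / N \<in> {real i / N..real (Suc i) / N}" "real (Suc i) / N \<in> {real i / N..real (Suc i) / N}"
      by (auto simp: divide_right_mono)
    from ae(3)[OF this(1)] ae(3)[OF this(2)] show ?thesis
      using ae(1,2) P(1,2) i by (intro connects_interval[of a _ e]) (auto simp: u_def)
  qed
  have time_drift: "\<bar>T i - real i / N\<bar> \<le> 1 / N" if "i \<le> N" for i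
  proof -
    have "T i - real i / N = (\<Sum>i'<i. \<Sum>j<K. P i' j - mass i' j)"
      using mass_row that by (simp add: T_def sum_subtractf)
    also have "\<bar>\<dots>\<bar> \<le> (\<Sum>i'<i. \<Sum>j<K. \<bar>P i' j - mass i' j\<bar>)"
      by (intro order_trans[OF sum_abs] sum_mono sum_abs)
    also have "\<dots> \<le> (\<Sum>i'<i. \<Sum>j<K. \<eta>)"
      using P(3) that by (intro sum_mono) auto
    also have "\<dots> = real i * (K * \<eta>)"
      by simp
    also have "\<dots> \<le> real N * (K * \<eta>)"
      using that \<open>0 < \<eta>\<close> by (intro mult_right_mono) auto
    also have "\<dots> = 1 / N"
      using N K by (simp add: \<eta>_def)
    finally show ?thesis .
  qed
  obtain xs where xs: "walk (u 0) xs (u N)" "load xs = (\<lambda>j. \<Sum>i<N. P i j)"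
    "\<And>k. k < length xs \<Longrightarrow> \<exists>i<N. T i \<le> duration (take k xs) \<and>
       duration (take (Suc k) xs) \<le> T (Suc i) \<and> 0 < P i (cell (xs ! k))"
  proof -
    have "P i j = 0" if "K \<le> j" for i j
      using P(2)[of i j] that by simp
    from concat_walks[of N u P K, OF connects this] show ?thesis
      using that unfolding T_def by blast
  qed
  have "load xs j = 1 / 2 ^ m" if "j < 2 ^ m" for j
    using P(4) that by (simp add: xs(2) K_def)
  moreover have "load xs j = 0" if "2 ^ m \<le> j" for j
    using P(2) that by (simp add: xs(2) K_def)
  ultimately obtain g where g: "g \<in> G_monoid" "\<And>x. x \<in> {0..1} \<Longrightarrow> \<exists>k<length xs.
      duration (take k xs) \<le> x \<and> x \<le> duration (take (Suc k) xs) \<and>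
      cell (xs ! k) / 2 ^ m \<le> g x \<and> g x \<le> Suc (cell (xs ! k)) / 2 ^ m"
    using realise_walk[OF xs(1)] by blast
  \<comment> \<open>At time \<open>x\<close> the walk crosses a cell \<open>j\<close> of positive
    mass in a row \<open>i\<close>, so \<open>b\<close> maps some \<open>y\<close> of
    \<open>I i\<close> into cell \<open>j\<close>. Then \<open>g x\<close> and \<open>b y\<close>
    share a cell of height below \<open>\<epsilon> / 4\<close>, and \<open>x\<close> is within
    \<open>2 / N\<close> of \<open>y\<close>.\<close>
  have close: "\<bar>b x - g x\<bar> \<le> \<epsilon> / 2" if x: "x \<in> {0..1}" for x
  proof -
    obtain k where k: "k < length xs" "duration (take k xs) \<le> x" "x \<le> duration (take (Suc k) xs)"
      "cell (xs ! k) / 2 ^ m \<le> g x" "g x \<le> Suc (cell (xs ! k)) / 2 ^ m"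
      using g(2)[OF x] by blast
    define j where "j = cell (xs ! k)"
    obtain i where i: "i < N" "T i \<le> duration (take k xs)" "duration (take (Suc k) xs) \<le> T (Suc i)"
      "0 < P i j"
      using xs(3)[OF k(1)] unfolding j_def by blast
    then have "0 < mass i j"
      using P(2) by (metis less_irrefl)
    then obtain y where y: "y \<in> I i" "f y \<in> J j"
      by (rule mass_pos_obtains)
    have y01: "y \<in> {0..1}"
      using y I_unit(2)[OF i(1)] by blast
    have "\<bar>T i - real i / N\<bar> \<le> 1 / N" "\<bar>T (Suc i) - real (Suc i) / N\<bar> \<le> 1 / N"
      using i(1) by (auto intro!: time_drift simp del: of_nat_Suc)
    moreover have "real (Suc i) / N = real i / N + 1 / N"
      by (simp add: add_divide_distrib)
    moreover have "real i / N < y" "y < real (Suc i) / N"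
      using y(1) by (simp_all add: I_def)
    ultimately have "\<bar>x - y\<bar> \<le> 2 * (1 / N)"
      using i(2,3) k(2,3) by linarith
    then have "\<bar>x - y\<bar> < \<delta>"
      using N_large by simp
    then have "\<bar>b x - b y\<bar> < \<epsilon> / 4"
      by (rule \<delta>(2)[OF x y01])
    moreover have "real j / 2 ^ m < b y" "b y < real (Suc j) / 2 ^ m"
      using y(2) f_eq[OF y01] by (simp_all add: J_def real_K)
    moreover have "real (Suc j) / 2 ^ m = real j / 2 ^ m + 1 / 2 ^ m"
      by (simp add: add_divide_distrib)
    ultimately show ?thesis
      using k(4,5) m unfolding j_def[symmetric] by linarith
  qed
  \<comment> \<open>A supremum preserves only weak inequalities, whence the bound by half of
    \<open>\<epsilon>\<close>.\<close>
  have "rho b g \<le> \<epsilon> / 2"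
    unfolding rho_def using close by (intro cSUP_least) auto
  with \<epsilon> g(1) show "\<exists>g\<in>G_monoid. rho b g < \<epsilon>"
    by (intro bexI[of _ g]) auto
qed

end
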